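(* Let $\widetilde{W_3}$ be the $5$-dimensional complex nilpotent metric Leibniz algebra with basis $e_1,\dots,e_5$ and nonzero brackets $[e_3,e_4]=e_2=-[e_4,e_3]$, $[e_3,e_5]=e_1=-[e_5,e_3]$, $[e_4,e_5]=e_3=-[e_5,e_4]$, $[e_5,e_5]=e_2$. Then $\widetilde{W_3}$ has two deformations to metric Leibniz algebras: one is isomorphic to the Leibniz algebra $\mathfrak{L}_2\oplus\mathbb{C}$, and the other is the nilpotent Leibniz algebra $\widetilde{W_3}^*$ with the original nonzero brackets of $\widetilde{W_3}$ and the extra nonzero bracket $[e_4,e_4]=e_1$. Here $\mathfrak{L}_2$ is the $4$-dimensional Leibniz algebra with nonzero brackets $[e_1,e_2]=e_3=-[e_2,e_1]$, $[e_1,e_4]=e_1=-[e_4,e_1]$, $[e_4,e_2]=e_2=-[e_2,e_4]$, $[e_4,e_4]=e_3$.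
   Context: All algebras are over $\mathbb{C}$. A left (resp. right) Leibniz algebra is a vector space $\mathfrak{L}$ with a bilinear bracket satisfying $[x,[y,z]]=[[x,y],z]+[y,[x,z]]$ (resp. $[x,[y,z]]=[[x,y],z]-[[x,z],y]$); a Leibniz algebra is one or the other. $\mathfrak{L}$ is nilpotent if $\mathfrak{L}^n=0$ for some $n$, where $\mathfrak{L}^1=\mathfrak{L}$, $\mathfrak{L}^{k+1}=[\mathfrak{L}^k,\mathfrak{L}]$. A bilinear form $B$ on $\mathfrak{L}$ is invariant if $B([x,y],z)=B(x,[y,z])$ for all $x,y,z$. $\mathfrak{L}$ is metric if it has a non-degenerate symmetric invariant bilinear form. $\mathbb{C}$ denotes the $1$-dimensional abelian algebra. A (formal $1$-parameter, Leibniz) deformation of $(\mathfrak{L},\mu_0)$ is a Leibniz bracket $\mu_t=\mu_0+t\phi_1+t^2\phi_2+\cdots$ on $\mathfrak{L}\otimes\mathbb{C}[[t]]$, with $\phi_i$ bilinear maps $\mathfrak{L}\times\mathfrak{L}\to\mathfrak{L}$. A deformation is to a Leibniz algebra $\mathfrak{N}$ if it is polynomial in $t$ and $(\mathfrak{L},\mu_t)\cong\mathfrak{N}$ for all nonzero $t$ near $0$. Deformations to metric algebras are understood to be non-trivial (the deformed algebra is not isomorphic to the original one).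
   Formalization: "Has two deformations" is proved as "has at least these two, with non-isomorphic targets"; that there are no others is false: [e5,e5]=e2+te1, [e4,e5]=e3-te2, [e5,e4]=-e3-te2 gives a third nilpotent metric target. *)

theory Defs
  imports "HOL-Analysis.Analysis" "HOL-Computational_Algebra.Formal_Power_Series"
begin

section \<open>Complex algebras and Leibniz algebras\<close>

text \<open>
  A complex algebra lives on a whole type; its scalar multiplication is an explicit component, so
  that the same notions apply to \<^typ>\<open>complex ^ 'n\<close> and to products.
\<close>

record 'a alg =
  scal :: "complex \<Rightarrow> 'a \<Rightarrow> 'a"
  brac :: "'a \<Rightarrow> 'a \<Rightarrow> 'a"

definition bilinear_op :: "('a::ab_group_add) alg \<Rightarrow> ('a \<Rightarrow> 'a \<Rightarrow> 'a) \<Rightarrow> bool" where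
  "bilinear_op A b \<longleftrightarrow>
     (\<forall>x. Vector_Spaces.linear (scal A) (scal A) (b x)) \<and>
     (\<forall>y. Vector_Spaces.linear (scal A) (scal A) (\<lambda>x. b x y))"

definition left_leibniz :: "('a::ab_group_add \<Rightarrow> 'a \<Rightarrow> 'a) \<Rightarrow> bool" where
  "left_leibniz b \<longleftrightarrow> (\<forall>x y z. b x (b y z) = b (b x y) z + b y (b x z))"

definition right_leibniz :: "('a::ab_group_add \<Rightarrow> 'a \<Rightarrow> 'a) \<Rightarrow> bool" where
  "right_leibniz b \<longleftrightarrow> (\<forall>x y z. b x (b y z) = b (b x y) z - b (b x z) y)"

definition leibniz_bracket :: "('a::ab_group_add \<Rightarrow> 'a \<Rightarrow> 'a) \<Rightarrow> bool" where
  "leibniz_bracket b \<longleftrightarrow> left_leibniz b \<or> right_leibniz b"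

definition leibniz_algebra :: "('a::ab_group_add) alg \<Rightarrow> bool" where
  "leibniz_algebra A \<longleftrightarrow>
     vector_space (scal A) \<and> bilinear_op A (brac A) \<and> leibniz_bracket (brac A)"

text \<open>The lower central series is indexed from 0 here: \<open>lower_central A k\<close> is $L^{k+1}$.\<close>

primrec lower_central :: "('a::ab_group_add) alg \<Rightarrow> nat \<Rightarrow> 'a set" where
  "lower_central A 0 = UNIV"
| "lower_central A (Suc k) =
     module.span (scal A) {brac A x y | x y. x \<in> lower_central A k}"

definition nilpotent_alg :: "('a::ab_group_add) alg \<Rightarrow> bool" where
  "nilpotent_alg A \<longleftrightarrow> (\<exists>k. lower_central A k = {0})"

definition bilinear_form :: "('a::ab_group_add) alg \<Rightarrow> ('a \<Rightarrow> 'a \<Rightarrow> complex) \<Rightarrow> bool" where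
  "bilinear_form A B \<longleftrightarrow>
     (\<forall>x. Vector_Spaces.linear (scal A) (*) (B x)) \<and>
     (\<forall>y. Vector_Spaces.linear (scal A) (*) (\<lambda>x. B x y))"

definition invariant_form :: "('a::ab_group_add) alg \<Rightarrow> ('a \<Rightarrow> 'a \<Rightarrow> complex) \<Rightarrow> bool" where
  "invariant_form A B \<longleftrightarrow> (\<forall>x y z. B (brac A x y) z = B x (brac A y z))"

definition metric_leibniz_algebra :: "('a::ab_group_add) alg \<Rightarrow> bool" where
  "metric_leibniz_algebra A \<longleftrightarrow> leibniz_algebra A \<and>
     (\<exists>B. bilinear_form A B \<and> (\<forall>x y. B x y = B y x) \<and> invariant_form A B \<and>
          (\<forall>x. (\<forall>y. B x y = 0) \<longrightarrow> x = 0))"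

definition alg_iso :: "('a::ab_group_add) alg \<Rightarrow> ('b::ab_group_add) alg \<Rightarrow> bool"
    (infix "\<cong>\<^sub>a" 50) where
  "A \<cong>\<^sub>a A' \<longleftrightarrow>
     (\<exists>f. Vector_Spaces.linear (scal A) (scal A') f \<and> bij f \<and>
          (\<forall>x y. f (brac A x y) = brac A' (f x) (f y)))"

definition direct_sum :: "'a alg \<Rightarrow> 'b alg \<Rightarrow> ('a \<times> 'b) alg" (infixr "\<oplus>\<^sub>a" 65) where
  "A \<oplus>\<^sub>a A' =
     \<lparr> scal = (\<lambda>c (x, x'). (scal A c x, scal A' c x')),
       brac = (\<lambda>(x, x') (y, y'). (brac A x y, brac A' x' y')) \<rparr>"

definition abelian_line :: "complex alg" where
  "abelian_line = \<lparr> scal = (*), brac = (\<lambda>x y. 0) \<rparr>"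


section \<open>Deformations\<close>

text \<open>
  For finite-dimensional $L$, the space $L \otimes \mathbf{C}[[t]]$ is the space $L[[t]]$ of formal
  power series with coefficients in $L$, i.e. the type \<^typ>\<open>'a fps\<close>.  The family \<open>\<phi>\<close> stands for
  $\mu_t = \sum_i t^i \phi_i$, extended $\mathbf{C}[[t]]$-bilinearly to $L[[t]]$.
\<close>

definition formal_bracket ::
    "(nat \<Rightarrow> 'a \<Rightarrow> 'a \<Rightarrow> 'a) \<Rightarrow> 'a fps \<Rightarrow> 'a fps \<Rightarrow> ('a::ab_group_add) fps" where
  "formal_bracket \<phi> X Y =
     Abs_fps (\<lambda>n. \<Sum>i\<le>n. \<Sum>j\<le>n - i. \<phi> i (fps_nth X j) (fps_nth Y (n - i - j)))"

definition leibniz_deformation ::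
    "('a::ab_group_add) alg \<Rightarrow> (nat \<Rightarrow> 'a \<Rightarrow> 'a \<Rightarrow> 'a) \<Rightarrow> bool" where
  "leibniz_deformation A \<phi> \<longleftrightarrow>
     \<phi> 0 = brac A \<and> (\<forall>i. bilinear_op A (\<phi> i)) \<and> leibniz_bracket (formal_bracket \<phi>)"

definition polynomial_deformation :: "(nat \<Rightarrow> 'a \<Rightarrow> 'a \<Rightarrow> 'a::ab_group_add) \<Rightarrow> bool" where
  "polynomial_deformation \<phi> \<longleftrightarrow> finite {i. \<phi> i \<noteq> (\<lambda>x y. 0)}"

text \<open>The algebra $(L, \mu_t)$ for a complex number \<open>t\<close>; meaningful for polynomial \<open>\<phi>\<close> only.\<close>

definition deformed_alg ::
    "('a::ab_group_add) alg \<Rightarrow> (nat \<Rightarrow> 'a \<Rightarrow> 'a \<Rightarrow> 'a) \<Rightarrow> complex \<Rightarrow> 'a alg" where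
  "deformed_alg A \<phi> t =
     A\<lparr> brac := (\<lambda>x y. \<Sum>i | \<phi> i \<noteq> (\<lambda>x y. 0). scal A (t ^ i) (\<phi> i x y)) \<rparr>"

definition deformation_to ::
    "('a::ab_group_add) alg \<Rightarrow> (nat \<Rightarrow> 'a \<Rightarrow> 'a \<Rightarrow> 'a) \<Rightarrow> ('b::ab_group_add) alg \<Rightarrow> bool" where
  "deformation_to A \<phi> N \<longleftrightarrow>
     leibniz_deformation A \<phi> \<and> polynomial_deformation \<phi> \<and>
     (\<forall>\<^sub>F t in at 0. deformed_alg A \<phi> t \<cong>\<^sub>a N)"

definition metric_deformation_to ::
    "('a::ab_group_add) alg \<Rightarrow> (nat \<Rightarrow> 'a \<Rightarrow> 'a \<Rightarrow> 'a) \<Rightarrow> ('b::ab_group_add) alg \<Rightarrow> bool" where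
  "metric_deformation_to A \<phi> N \<longleftrightarrow>
     deformation_to A \<phi> N \<and> metric_leibniz_algebra N \<and> \<not> A \<cong>\<^sub>a N"


section \<open>The algebras\<close>

abbreviation e :: "'n::finite \<Rightarrow> complex ^ 'n" where
  "e i \<equiv> axis i 1"

text \<open>
  \<open>table_alg c\<close> is the algebra on \<^typ>\<open>complex ^ 'n\<close> with $[e_i, e_j]$ = \<open>c (i, j)\<close>.  In the
  numeral types \<open>4\<close> and \<open>5\<close> used as index types the index \<open>n\<close> is the element 0, distinct from
  $1, \dots, n - 1$.
\<close>

definition table_alg :: "('n::finite \<times> 'n \<Rightarrow> complex ^ 'n) \<Rightarrow> (complex ^ 'n) alg" where
  "table_alg c =
     \<lparr> scal = (*s),
       brac = (\<lambda>x y. \<Sum>i\<in>UNIV. \<Sum>j\<in>UNIV. (x $ i * y $ j) *s c (i, j)) \<rparr>"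

definition W3_tilde_table :: "5 \<times> 5 \<Rightarrow> complex ^ 5" where
  "W3_tilde_table = (\<lambda>_. 0)
     ((3, 4) := e 2, (4, 3) := - e 2,
      (3, 5) := e 1, (5, 3) := - e 1,
      (4, 5) := e 3, (5, 4) := - e 3,
      (5, 5) := e 2)"

definition W3_tilde :: "(complex ^ 5) alg" where
  "W3_tilde = table_alg W3_tilde_table"

text \<open>
  These two targets do not exhaust the metric algebras that \<open>W3_tilde\<close> deforms to, so ``has two
  deformations to metric Leibniz algebras'' is meant existentially, with non-isomorphic targets.
  For instance, changing $[e_5, e_5]$ to $e_2 + t e_1$, $[e_4, e_5]$ to $e_3 - t e_2$ and
  $[e_5, e_4]$ to $- e_3 - t e_2$ is a non-trivial deformation to a nilpotent metric algebra
  isomorphic to neither of them.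
\<close>

definition W3_tilde_star :: "(complex ^ 5) alg" where
  "W3_tilde_star = table_alg (W3_tilde_table((4, 4) := e 1))"

definition L2 :: "(complex ^ 4) alg" where
  "L2 = table_alg ((\<lambda>_. 0)
     ((1, 2) := e 3, (2, 1) := - e 3,
      (1, 4) := e 1, (4, 1) := - e 1,
      (4, 2) := e 2, (2, 4) := - e 2,
      (4, 4) := e 3))"

end

theory Submission
  imports Defs
begin

text \<open>
  A metric Leibniz bracket is governed by its trilinear form \<open>B [x, y] z\<close>.  For \<open>W3_tilde\<close> this is
  the alternating form \<open>x\<^sub>3 \<and> x\<^sub>4 \<and> x\<^sub>5\<close> plus the cube \<open>x\<^sub>5\<^sup>3\<close>.  Replacing the factor \<open>x\<^sub>4\<close> by \<open>x\<^sub>4 + t x\<^sub>1\<close>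
  deforms it to \<open>L2\<close> plus a line, and subtracting \<open>t x\<^sub>4\<^sup>3\<close> deforms it to \<open>W3_tilde_star\<close>; both
  deformations are of first order in \<open>t\<close>.  Taking coordinates in $\mathbf{C}[[t]]$ turns the formal
  Leibniz identity into an identity in a commutative ring.  The algebras are told apart by
  \<open>[y, [y, [y, x]]]\<close>, which vanishes on the two nilpotent ones only, and by the span of the
  squares \<open>[x, x]\<close>, a line in \<open>W3_tilde\<close> and a plane in \<open>W3_tilde_star\<close>.
\<close>

section \<open>The index type \<open>5\<close>\<close>

lemma exhaust_5: fixes x :: 5 shows "x = 1 \<or> x = 2 \<or> x = 3 \<or> x = 4 \<or> x = 5"
proof (induct x)
  case (of_int z)
  \<comment> \<open>Representatives run from 0 to 4, and 0 is the same element as the numeral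
    5.\<close>
  then have "z = 0 \<or> z = 1 \<or> z = 2 \<or> z = 3 \<or> z = 4" by fastforce
  then show ?case by auto
qed

lemma UNIV_5: "UNIV = {1::5, 2, 3, 4, 5}"
  using exhaust_5 by auto

lemma forall_5: "(\<forall>i::5. P i) \<longleftrightarrow> P 1 \<and> P 2 \<and> P 3 \<and> P 4 \<and> P 5"
  by (metis exhaust_5)

lemma sum_5: "sum f (UNIV::5 set) = f 1 + f 2 + f 3 + f 4 + f 5"
  unfolding UNIV_5 by (simp add: algebra_simps)

section \<open>Isomorphisms, their invariants and the lower central series\<close>

lemma alg_isoI:
  assumes "Vector_Spaces.linear (scal A) (scal A') f"
    and "\<And>x. g (f x) = x" "\<And>y. f (g y) = y"
    and "\<And>x y. f (brac A x y) = brac A' (f x) (f y)"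
  shows "A \<cong>\<^sub>a A'"
proof -
  have "bij f" using assms(2,3) by (intro o_bij[where g = g]) auto
  then show ?thesis unfolding alg_iso_def using assms(1,4) by blast
qed

lemma alg_iso_sym:
  assumes "A \<cong>\<^sub>a A'"
  shows "A' \<cong>\<^sub>a A"
proof -
  obtain f where lin: "Vector_Spaces.linear (scal A) (scal A') f" and "bij f"
    and f: "\<And>x y. f (brac A x y) = brac A' (f x) (f y)"
    using assms unfolding alg_iso_def by blast
  have inv: "inv f (f x) = x" "f (inv f y) = y" for x y
    using \<open>bij f\<close> by (simp_all add: bij_is_inj bij_is_surj surj_f_inv_f)
  have lin': "f (x + y) = f x + f y" "f (scal A c x) = scal A' c (f x)" for x y c
    using lin unfolding Vector_Spaces.linear_iff by blast+
  \<comment> \<open>Injectivity lets every equation about \<open>inv f\<close> be checked after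
    applying \<open>f\<close>.\<close>
  have eqI: "x = y" if "f x = f y" for x y
    using that inv(1) by metis
  have "Vector_Spaces.linear (scal A') (scal A) (inv f)"
    using lin unfolding Vector_Spaces.linear_iff by (auto intro!: eqI simp: lin' inv)
  then show ?thesis
    by (rule alg_isoI[where g = f]) (auto intro!: eqI simp: inv f)
qed

text \<open>\<open>f\<close> carries the triple bracket to the triple bracket of the images, and
  injectivity pulls the vanishing back to \<open>A\<close>.\<close>

lemma alg_iso_ad_cubed_eq_0:
  assumes "A \<cong>\<^sub>a A'" and "\<And>x y. brac A' y (brac A' y (brac A' y x)) = 0"
  shows "brac A y (brac A y (brac A y x)) = 0"
proof -
  obtain f where lin: "Vector_Spaces.linear (scal A) (scal A') f" and "bij f"
    and f: "\<And>x y. f (brac A x y) = brac A' (f x) (f y)"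
    using assms unfolding alg_iso_def by blast
  have "f 0 = 0"
    using lin by (simp add: Vector_Spaces.linear_iff_module_hom module_hom.zero)
  moreover have "f (brac A y (brac A y (brac A y x))) = 0"
    by (simp add: f assms)
  ultimately show ?thesis
    using \<open>bij f\<close> by (metis bij_is_inj injD)
qed

text \<open>Multiples of \<open>v\<close> go to multiples of \<open>f v\<close>, and by surjectivity
  every square in \<open>A'\<close> is the image of a square in \<open>A\<close>.\<close>

lemma alg_iso_squares_on_line:
  assumes "A \<cong>\<^sub>a A'" and "\<And>x. \<exists>c. brac A x x = scal A c v"
  shows "\<exists>w. \<forall>x. \<exists>c. brac A' x x = scal A' c w"
proof -
  obtain f where lin: "Vector_Spaces.linear (scal A) (scal A') f" and "bij f"
    and f: "\<And>x y. f (brac A x y) = brac A' (f x) (f y)"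
    using assms unfolding alg_iso_def by blast
  have "\<exists>c. brac A' x x = scal A' c (f v)" for x
  proof -
    obtain y where "x = f y"
      using \<open>bij f\<close> by (metis bij_pointE)
    moreover obtain c where "brac A y y = scal A c v"
      using assms(2) by blast
    moreover have "f (scal A c v) = scal A' c (f v)"
      using lin unfolding Vector_Spaces.linear_iff by blast
    ultimately show ?thesis by (metis f)
  qed
  then show ?thesis by blast
qed

text \<open>The next term is the least subspace containing these brackets, so the series can be
  bounded from above without being computed.\<close>

lemma lower_central_Suc_subset:
  assumes "vector_space (scal A)" and "module.subspace (scal A) S"
    and "\<And>x y. x \<in> lower_central A k \<Longrightarrow> brac A x y \<in> S"
  shows "lower_central A (Suc k) \<subseteq> S"
proof -
  interpret vector_space "scal A" by fact
  show ?thesis using assms(2,3) unfolding lower_central.simps by (intro span_minimal) auto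
qed

section \<open>Table algebras and direct sums\<close>

lemma scal_table_alg [simp]: "scal (table_alg c) = (*s)"
  by (simp add: table_alg_def)

lemma bilinear_op_table_alg: "bilinear_op (table_alg c) (brac (table_alg d))"
  unfolding bilinear_op_def Vector_Spaces.linear_iff
  by (simp add: table_alg_def vec.vector_space_axioms vec_eq_iff sum.distrib
      sum_distrib_left algebra_simps)

lemma scal_direct_sum [simp]:
  "scal (A \<oplus>\<^sub>a A') c p = (scal A c (fst p), scal A' c (snd p))"
  by (simp add: direct_sum_def split_beta)

lemma brac_direct_sum [simp]:
  "brac (A \<oplus>\<^sub>a A') p q = (brac A (fst p) (fst q), brac A' (snd p) (snd q))"
  by (simp add: direct_sum_def split_beta)

lemma vector_space_direct_sum:
  assumes "vector_space (scal A)" "vector_space (scal A')"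
  shows "vector_space (scal (A \<oplus>\<^sub>a A'))"
  using assms by (simp add: vector_space_def)

lemma bilinear_op_direct_sum:
  assumes "bilinear_op A (brac A)" "bilinear_op A' (brac A')"
  shows "bilinear_op (A \<oplus>\<^sub>a A') (brac (A \<oplus>\<^sub>a A'))"
  using assms unfolding bilinear_op_def Vector_Spaces.linear_iff
  by (simp add: vector_space_direct_sum)

text \<open>The sum of a left and a right Leibniz algebra may be neither, so both summands are taken
  on the same side.\<close>

lemma leibniz_algebra_direct_sum:
  assumes "leibniz_algebra A" "leibniz_algebra A'"
    and "left_leibniz (brac A)" "left_leibniz (brac A')"
  shows "leibniz_algebra (A \<oplus>\<^sub>a A')"
proof -
  have "left_leibniz (brac (A \<oplus>\<^sub>a A'))"
    unfolding left_leibniz_def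
  proof (intro allI)
    fix x y z
    show "brac (A \<oplus>\<^sub>a A') x (brac (A \<oplus>\<^sub>a A') y z) =
        brac (A \<oplus>\<^sub>a A') (brac (A \<oplus>\<^sub>a A') x y) z + brac (A \<oplus>\<^sub>a A') y (brac (A \<oplus>\<^sub>a A') x z)"
      using assms(3)[unfolded left_leibniz_def, rule_format, of "fst x" "fst y" "fst z"]
        assms(4)[unfolded left_leibniz_def, rule_format, of "snd x" "snd y" "snd z"]
      by simp
  qed
  with assms(1,2) show ?thesis
    by (simp add: leibniz_algebra_def leibniz_bracket_def vector_space_direct_sum
        bilinear_op_direct_sum)
qed

lemma metric_leibniz_algebraD: "metric_leibniz_algebra A \<Longrightarrow> leibniz_algebra A"
  unfolding metric_leibniz_algebra_def by (rule conjunct1)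

text \<open>The orthogonal sum \<open>C\<close> of the two forms serves; all its properties hold
  summand by summand.\<close>

lemma metric_leibniz_algebra_direct_sum:
  assumes "metric_leibniz_algebra A" "metric_leibniz_algebra A'"
    and "left_leibniz (brac A)" "left_leibniz (brac A')"
  shows "metric_leibniz_algebra (A \<oplus>\<^sub>a A')"
proof -
  obtain B where B: "bilinear_form A B" "\<forall>x y. B x y = B y x" "invariant_form A B"
      "\<forall>x. (\<forall>y. B x y = 0) \<longrightarrow> x = 0"
    using assms(1) unfolding metric_leibniz_algebra_def by blast
  obtain B' where B': "bilinear_form A' B'" "\<forall>x y. B' x y = B' y x" "invariant_form A' B'"
      "\<forall>x. (\<forall>y. B' x y = 0) \<longrightarrow> x = 0"
    using assms(2) unfolding metric_leibniz_algebra_def by blast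
  define C where "C p q = B (fst p) (fst q) + B' (snd p) (snd q)" for p q
  have zero: "B x 0 = 0" "B' x' 0 = 0" for x x'
  proof -
    have "module_hom (scal A) (*) (B x)" "module_hom (scal A') (*) (B' x')"
      using B(1) B'(1) unfolding bilinear_form_def Vector_Spaces.linear_iff_module_hom by blast+
    then show "B x 0 = 0" "B' x' 0 = 0"
      by (simp_all add: module_hom.zero)
  qed
  have "bilinear_form (A \<oplus>\<^sub>a A') C"
    using B(1) B'(1) unfolding bilinear_form_def Vector_Spaces.linear_iff C_def
    by (simp add: vector_space_direct_sum algebra_simps)
  moreover have "\<forall>p q. C p q = C q p"
    unfolding C_def by (intro allI arg_cong2[where f = "(+)"] B(2)[rule_format] B'(2)[rule_format])
  moreover have "invariant_form (A \<oplus>\<^sub>a A') C"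
    using B(3) B'(3) by (simp add: invariant_form_def C_def)
  moreover have "\<forall>p. (\<forall>q. C p q = 0) \<longrightarrow> p = 0"
  proof (intro allI impI prod_eqI)
    fix p assume p: "\<forall>q. C p q = 0"
    \<comment> \<open>Pairing with \<open>(y, 0)\<close> kills the second term of \<open>C\<close>,
      which isolates \<open>B\<close>.\<close>
    have "B (fst p) y = 0" for y
      using p[rule_format, of "(y, 0)"] by (simp add: C_def zero)
    then show "fst p = fst 0"
      unfolding fst_zero by (intro B(4)[rule_format])
    have "B' (snd p) y = 0" for y
      using p[rule_format, of "(0, y)"] by (simp add: C_def zero)
    then show "snd p = snd 0"
      unfolding snd_zero by (intro B'(4)[rule_format])
  qed
  moreover have "leibniz_algebra (A \<oplus>\<^sub>a A')"
    using assms by (intro leibniz_algebra_direct_sum metric_leibniz_algebraD)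
  ultimately show ?thesis
    unfolding metric_leibniz_algebra_def by blast
qed

lemma left_leibniz_abelian_line: "left_leibniz (brac abelian_line)"
  by (simp add: left_leibniz_def abelian_line_def)

lemma metric_leibniz_algebra_abelian_line: "metric_leibniz_algebra abelian_line"
proof -
  have "leibniz_algebra abelian_line"
    using left_leibniz_abelian_line
    by (simp add: leibniz_algebra_def leibniz_bracket_def bilinear_op_def Vector_Spaces.linear_iff
        abelian_line_def vector_space_over_itself.vector_space_axioms)
  moreover have "bilinear_form abelian_line (*)" "invariant_form abelian_line (*)"
    by (simp_all add: bilinear_form_def invariant_form_def Vector_Spaces.linear_iff abelian_line_def
        vector_space_over_itself.vector_space_axioms algebra_simps)
  moreover have "x = 0" if "\<forall>y. x * y = 0" for x :: complex
    using that[rule_format, of 1] by simp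
  moreover have "\<forall>x y::complex. x * y = y * x"
    by (simp add: mult.commute)
  ultimately show ?thesis
    unfolding metric_leibniz_algebra_def by blast
qed

section \<open>First-order deformations in power series coordinates\<close>

text \<open>The vanishing coefficients are brackets of the zero table, so that every coefficient has
  the shape treated by \<open>coord_formal_bracket\<close>.\<close>

definition first_order :: "('n::finite \<times> 'n \<Rightarrow> complex ^ 'n) \<Rightarrow> ('n \<times> 'n \<Rightarrow> complex ^ 'n)
    \<Rightarrow> nat \<Rightarrow> complex ^ 'n \<Rightarrow> complex ^ 'n \<Rightarrow> complex ^ 'n" where
  "first_order c d i = brac (table_alg (if i = 0 then c else if i = 1 then d else (\<lambda>_. 0)))"

definition coord :: "'n::finite \<Rightarrow> (complex ^ 'n) fps \<Rightarrow> complex fps" where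
  "coord k X = Abs_fps (\<lambda>n. fps_nth X n $ k)"

lemma coord_add [simp]: "coord k (X + Y) = coord k X + coord k Y"
  by (simp add: coord_def fps_eq_iff)

lemma fps_vec_eq_iff: "X = Y \<longleftrightarrow> (\<forall>k. coord k X = coord k Y)"
  by (auto simp: coord_def fps_eq_iff vec_eq_iff)

text \<open>The formal bracket is bilinear over the power series ring, and its structure constants
  are the series collecting the entries of all the tables \<open>c i\<close>. The proof moves the
  sums over the basis indices out of the convolution.\<close>

lemma coord_formal_bracket:
  "coord k (formal_bracket (\<lambda>i. brac (table_alg (c i))) X Y) =
     (\<Sum>a\<in>UNIV. \<Sum>b\<in>UNIV. Abs_fps (\<lambda>i. c i (a, b) $ k) * (coord a X * coord b Y))"
proof (rule fps_ext)
  fix n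
  have "fps_nth (coord k (formal_bracket (\<lambda>i. brac (table_alg (c i))) X Y)) n =
      (\<Sum>i\<le>n. \<Sum>j\<le>n - i. \<Sum>a\<in>UNIV. \<Sum>b\<in>UNIV.
        fps_nth X j $ a * fps_nth Y (n - i - j) $ b * c i (a, b) $ k)"
    by (simp add: coord_def formal_bracket_def table_alg_def)
  also have "\<dots> = (\<Sum>i\<le>n. \<Sum>a\<in>UNIV. \<Sum>j\<le>n - i. \<Sum>b\<in>UNIV.
        fps_nth X j $ a * fps_nth Y (n - i - j) $ b * c i (a, b) $ k)"
    by (intro sum.cong refl sum.swap)
  also have "\<dots> = (\<Sum>i\<le>n. \<Sum>a\<in>UNIV. \<Sum>b\<in>UNIV. \<Sum>j\<le>n - i.
        fps_nth X j $ a * fps_nth Y (n - i - j) $ b * c i (a, b) $ k)"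
    by (intro sum.cong refl sum.swap)
  also have "\<dots> = (\<Sum>a\<in>UNIV. \<Sum>i\<le>n. \<Sum>b\<in>UNIV. \<Sum>j\<le>n - i.
        fps_nth X j $ a * fps_nth Y (n - i - j) $ b * c i (a, b) $ k)"
    by (rule sum.swap)
  also have "\<dots> = (\<Sum>a\<in>UNIV. \<Sum>b\<in>UNIV. \<Sum>i\<le>n. \<Sum>j\<le>n - i.
        fps_nth X j $ a * fps_nth Y (n - i - j) $ b * c i (a, b) $ k)"
    by (intro sum.cong refl sum.swap)
  also have "\<dots> = fps_nth (\<Sum>a\<in>UNIV. \<Sum>b\<in>UNIV.
      Abs_fps (\<lambda>i. c i (a, b) $ k) * (coord a X * coord b Y)) n"
    \<comment> \<open>The two instances expand the outer product first and the inner one second,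
      which yields the nested convolution of \<open>formal_bracket\<close>.\<close>
    unfolding fps_sum_nth fps_mult_nth[of "Abs_fps _"] fps_mult_nth[of "coord _ X"]
    by (simp add: coord_def sum_distrib_left atLeast0AtMost mult_ac)
  finally show "fps_nth (coord k (formal_bracket (\<lambda>i. brac (table_alg (c i))) X Y)) n =
      fps_nth (\<Sum>a\<in>UNIV. \<Sum>b\<in>UNIV.
        Abs_fps (\<lambda>i. c i (a, b) $ k) * (coord a X * coord b Y)) n" .
qed

lemma coord_formal_first_order:
  "coord k (formal_bracket (first_order c d) X Y) =
     (\<Sum>a\<in>UNIV. \<Sum>b\<in>UNIV. (fps_const (c (a, b) $ k) + fps_X * fps_const (d (a, b) $ k))
        * (coord a X * coord b Y))"
proof -
  have "Abs_fps (\<lambda>i. (if i = 0 then c else if i = 1 then d else (\<lambda>_. 0)) p $ k) =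
      fps_const (c p $ k) + fps_X * fps_const (d p $ k)" for p
    by (auto simp: fps_eq_iff)
  then show ?thesis
    using coord_formal_bracket[of k "\<lambda>i. if i = 0 then c else if i = 1 then d else (\<lambda>_. 0)" X Y]
    by (simp add: first_order_def[abs_def])
qed

lemma first_order_eq_0: "i \<noteq> 0 \<Longrightarrow> i \<noteq> 1 \<Longrightarrow> first_order c d i = (\<lambda>x y. 0)"
  by (simp add: first_order_def table_alg_def fun_eq_iff)

lemma first_order_support: "{i. first_order c d i \<noteq> (\<lambda>x y. 0)} \<subseteq> {0, 1}"
  using first_order_eq_0 by blast

lemma polynomial_deformation_first_order: "polynomial_deformation (first_order c d)"
  unfolding polynomial_deformation_def
  by (rule finite_subset[OF first_order_support]) simp

lemma deformed_alg_first_order: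
  "deformed_alg (table_alg c) (first_order c d) t = table_alg (\<lambda>p. c p + t *s d p)"
proof -
  have "(\<Sum>i | first_order c d i \<noteq> (\<lambda>x y. 0). t ^ i *s first_order c d i x y) =
      brac (table_alg (\<lambda>p. c p + t *s d p)) x y" for x y
  proof -
    \<comment> \<open>The support may be smaller than \<open>{0, 1}\<close> when a table gives the
      zero map; the added terms are zero.\<close>
    have "(\<Sum>i | first_order c d i \<noteq> (\<lambda>x y. 0). t ^ i *s first_order c d i x y) =
        (\<Sum>i\<in>{0, 1}. t ^ i *s first_order c d i x y)"
      by (rule sum.mono_neutral_left[OF _ first_order_support]) auto
    then show ?thesis
      by (simp add: first_order_def table_alg_def vec_eq_iff sum.distrib sum_distrib_left
          algebra_simps)
  qed
  then show ?thesis by (simp add: deformed_alg_def table_alg_def)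
qed

lemma deformation_to_first_order:
  assumes "left_leibniz (formal_bracket (first_order c d))"
    and "\<And>t. t \<noteq> 0 \<Longrightarrow> table_alg (\<lambda>p. c p + t *s d p) \<cong>\<^sub>a N"
  shows "deformation_to (table_alg c) (first_order c d) N"
proof -
  have "leibniz_deformation (table_alg c) (first_order c d)"
    using assms(1) unfolding leibniz_deformation_def leibniz_bracket_def
    by (auto simp: first_order_def bilinear_op_table_alg)
  moreover have "\<forall>\<^sub>F t in at 0. deformed_alg (table_alg c) (first_order c d) t \<cong>\<^sub>a N"
    \<comment> \<open>The isomorphism exists for every nonzero \<open>t\<close>, so the radius 1 is
      arbitrary.\<close>
    unfolding deformed_alg_first_order
    using assms(2) by (auto simp: eventually_at intro: exI[of _ 1])
  ultimately show ?thesis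
    by (simp add: deformation_to_def polynomial_deformation_first_order)
qed

section \<open>The family through \<open>W3_tilde\<close> and \<open>W3_tilde_star\<close>\<close>

text \<open>The values \<open>u = 0\<close> and \<open>u = 1\<close> are the two algebras of the
  theorem, so their common properties are proved once; the star deformation runs along this
  family.\<close>

definition W3_curve :: "complex \<Rightarrow> (complex ^ 5) alg" where
  "W3_curve u = table_alg (W3_tilde_table((4, 4) := u *s e 1))"

lemma scal_W3_curve [simp]: "scal (W3_curve u) = (*s)"
  by (simp add: W3_curve_def)

lemma W3_curve_0: "W3_curve 0 = W3_tilde"
  by (simp add: W3_curve_def W3_tilde_def W3_tilde_table_def fun_upd_idem)

lemma W3_curve_1: "W3_curve 1 = W3_tilde_star"
  by (simp add: W3_curve_def W3_tilde_star_def)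

lemma brac_W3_curve:
  "brac (W3_curve u) x y $ 1 = x$3 * y$5 - x$5 * y$3 + u * x$4 * y$4"
  "brac (W3_curve u) x y $ 2 = x$3 * y$4 - x$4 * y$3 + x$5 * y$5"
  "brac (W3_curve u) x y $ 3 = x$4 * y$5 - x$5 * y$4"
  "brac (W3_curve u) x y $ 4 = 0"
  "brac (W3_curve u) x y $ 5 = 0"
  by (simp_all add: W3_curve_def table_alg_def W3_tilde_table_def sum_5 axis_def algebra_simps)

lemma leibniz_algebra_W3_curve: "leibniz_algebra (W3_curve u)"
proof -
  have "left_leibniz (brac (W3_curve u))"
    by (simp add: left_leibniz_def vec_eq_iff forall_5 brac_W3_curve algebra_simps)
  then show ?thesis
    using bilinear_op_table_alg
    by (simp add: leibniz_algebra_def leibniz_bracket_def W3_curve_def vec.vector_space_axioms)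
qed

lemma metric_leibniz_algebra_W3_curve: "metric_leibniz_algebra (W3_curve u)"
proof -
  \<comment> \<open>For this form \<open>B [x, y] z\<close> is the determinant of coordinates 3, 4,
    5 plus \<open>x$5 * y$5 * z$5 - u * x$4 * y$4 * z$4\<close>. It is invariant under cyclic
    permutation, which together with symmetry gives invariance.\<close>
  define B :: "complex ^ 5 \<Rightarrow> complex ^ 5 \<Rightarrow> complex" where
    "B x y = x$2 * y$5 + x$5 * y$2 + x$3 * y$3 - x$1 * y$4 - x$4 * y$1" for x y
  have "bilinear_form (W3_curve u) B"
    by (simp add: bilinear_form_def Vector_Spaces.linear_iff B_def vec.vector_space_axioms
        vector_space_over_itself.vector_space_axioms algebra_simps)
  moreover have "\<forall>x y. B x y = B y x"
    by (simp add: B_def algebra_simps)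
  moreover have "invariant_form (W3_curve u) B"
    by (simp add: invariant_form_def B_def brac_W3_curve algebra_simps)
  moreover have "x = 0" if x: "\<forall>y. B x y = 0" for x
    using x[rule_format, of "e 1"] x[rule_format, of "e 2"] x[rule_format, of "e 3"]
      x[rule_format, of "e 4"] x[rule_format, of "e 5"]
    by (simp add: B_def axis_def vec_eq_iff forall_5)
  ultimately show ?thesis
    using leibniz_algebra_W3_curve unfolding metric_leibniz_algebra_def by blast
qed

lemma nilpotent_alg_W3_curve: "nilpotent_alg (W3_curve u)"
proof -
  let ?L = "lower_central (W3_curve u)"
  note subset = lower_central_Suc_subset[of "W3_curve u", unfolded scal_W3_curve,
      OF vec.vector_space_axioms]
  \<comment> \<open>The bounds are the spans of \<open>e 1, e 2, e 3\<close>, then of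
    \<open>e 1, e 2\<close>, then 0.\<close>
  have 1: "?L (Suc 0) \<subseteq> {x. x$4 = 0 \<and> x$5 = 0}"
    by (rule subset) (auto simp: vec.subspace_def brac_W3_curve)
  have 2: "?L (Suc (Suc 0)) \<subseteq> {x. x$3 = 0 \<and> x$4 = 0 \<and> x$5 = 0}"
    using 1 by (intro subset) (auto simp: vec.subspace_def brac_W3_curve
        simp del: lower_central.simps)
  have 3: "?L (Suc (Suc (Suc 0))) \<subseteq> {0}"
    using 2 by (intro subset) (auto simp: vec.subspace_def brac_W3_curve vec_eq_iff forall_5
        simp del: lower_central.simps)
  moreover have "0 \<in> ?L (Suc (Suc (Suc 0)))"
    by (simp add: vec.span_zero)
  ultimately show ?thesis
    unfolding nilpotent_alg_def by blast
qed

text \<open>Left multiplication by \<open>y\<close> descends the same chain of coordinate subspaces,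
  reaching 0 in three steps.\<close>

lemma ad_cubed_W3_curve:
  "brac (W3_curve u) y (brac (W3_curve u) y (brac (W3_curve u) y x)) = 0"
  by (simp add: vec_eq_iff forall_5 brac_W3_curve)

lemma not_W3_tilde_iso_star: "\<not> W3_tilde \<cong>\<^sub>a W3_tilde_star"
proof
  assume iso: "W3_tilde \<cong>\<^sub>a W3_tilde_star"
  have "\<exists>c. brac W3_tilde x x = scal W3_tilde c (e 2)" for x
    unfolding W3_curve_0[symmetric]
    by (rule exI[of _ "x$5 * x$5"]) (simp add: vec_eq_iff forall_5 brac_W3_curve axis_def)
  then obtain w where w: "\<And>x. \<exists>c. brac (W3_curve 1) x x = c *s w"
    using alg_iso_squares_on_line[OF iso] unfolding W3_curve_1[symmetric] scal_W3_curve by blast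
  obtain a b where "brac (W3_curve 1) (e 4) (e 4) = a *s w" "brac (W3_curve 1) (e 5) (e 5) = b *s w"
    using w by blast
  \<comment> \<open>The first equation makes \<open>w$1\<close> nonzero, the second then forces
    \<open>b = 0\<close>, against the third.\<close>
  then have "a * w$1 = 1" "b * w$1 = 0" "b * w$2 = 1"
    by (simp_all add: vec_eq_iff forall_5 brac_W3_curve axis_def)
  then show False by auto
qed

section \<open>The algebra \<open>L2\<close>\<close>

lemma brac_L2:
  "brac L2 x y $ 1 = x$1 * y$4 - x$4 * y$1"
  "brac L2 x y $ 2 = x$4 * y$2 - x$2 * y$4"
  "brac L2 x y $ 3 = x$1 * y$2 - x$2 * y$1 + x$4 * y$4"
  "brac L2 x y $ 4 = 0"
  by (simp_all add: L2_def table_alg_def sum_4 axis_def)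

lemma left_leibniz_L2: "left_leibniz (brac L2)"
  by (simp add: left_leibniz_def vec_eq_iff forall_4 brac_L2 algebra_simps)

lemma scal_L2 [simp]: "scal L2 = (*s)"
  by (simp add: L2_def)

lemma leibniz_algebra_L2: "leibniz_algebra L2"
  using left_leibniz_L2 bilinear_op_table_alg
  by (simp add: leibniz_algebra_def leibniz_bracket_def L2_def vec.vector_space_axioms)

lemma metric_leibniz_algebra_L2: "metric_leibniz_algebra L2"
proof -
  \<comment> \<open>Here \<open>B [x, y] z\<close> is the determinant of coordinates 1, 2, 4 plus
    \<open>x$4 * y$4 * z$4\<close>, again cyclic.\<close>
  define B :: "complex ^ 4 \<Rightarrow> complex ^ 4 \<Rightarrow> complex" where
    "B x y = x$3 * y$4 + x$4 * y$3 - x$1 * y$2 - x$2 * y$1" for x y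
  have "bilinear_form L2 B"
    by (simp add: bilinear_form_def Vector_Spaces.linear_iff B_def vec.vector_space_axioms
        vector_space_over_itself.vector_space_axioms algebra_simps)
  moreover have "\<forall>x y. B x y = B y x"
    by (simp add: B_def algebra_simps)
  moreover have "invariant_form L2 B"
    by (simp add: invariant_form_def B_def brac_L2 algebra_simps)
  moreover have "x = 0" if x: "\<forall>y. B x y = 0" for x
    using x[rule_format, of "e 1"] x[rule_format, of "e 2"] x[rule_format, of "e 3"]
      x[rule_format, of "e 4"]
    by (simp add: B_def axis_def vec_eq_iff forall_4)
  ultimately show ?thesis
    using leibniz_algebra_L2 unfolding metric_leibniz_algebra_def by blast
qed

text \<open>In \<open>L2\<close> left multiplication by \<open>e 4\<close> fixes \<open>e 2\<close>,
  so its cube does not vanish.\<close>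

lemma not_L2_line_iso_W3_curve: "\<not> (L2 \<oplus>\<^sub>a abelian_line) \<cong>\<^sub>a W3_curve u"
proof
  let ?b = "brac (L2 \<oplus>\<^sub>a abelian_line)"
  assume "(L2 \<oplus>\<^sub>a abelian_line) \<cong>\<^sub>a W3_curve u"
  then have "?b (e 4, 0) (?b (e 4, 0) (?b (e 4, 0) (e 2, 0))) = 0"
    by (rule alg_iso_ad_cubed_eq_0) (rule ad_cubed_W3_curve)
  then have "brac L2 (e 4) (brac L2 (e 4) (brac L2 (e 4) (e 2))) $ 2 = 0"
    by (simp add: zero_prod_def)
  then show False by (simp add: brac_L2 axis_def)
qed

section \<open>The two deformations and their targets\<close>

text \<open>With respect to the form chosen on \<open>W3_curve u\<close>, this is the bracket whose
  trilinear form is the determinant of coordinates 3, 1, 5.\<close>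

definition L2_direction :: "5 \<times> 5 \<Rightarrow> complex ^ 5" where
  "L2_direction = (\<lambda>_. 0)
     ((3, 1) := e 2, (1, 3) := - e 2,
      (1, 5) := e 3, (5, 1) := - e 3,
      (3, 5) := e 4, (5, 3) := - e 4)"

definition star_direction :: "5 \<times> 5 \<Rightarrow> complex ^ 5" where
  "star_direction = (\<lambda>_. 0)((4, 4) := e 1)"

text \<open>The symmetric term \<open>coord 5 X * coord 5 Y\<close> has central values and vanishes
  on brackets, so what remains is the Jacobi identity of the skew part.\<close>

lemma left_leibniz_L2_direction:
  "left_leibniz (formal_bracket (first_order W3_tilde_table L2_direction))"
proof -
  let ?b = "formal_bracket (first_order W3_tilde_table L2_direction)"
  have coord_bracket: "coord 1 (?b X Y) = coord 3 X * coord 5 Y - coord 5 X * coord 3 Y"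
    "coord 2 (?b X Y) = coord 3 X * coord 4 Y - coord 4 X * coord 3 Y + coord 5 X * coord 5 Y
       + fps_X * (coord 3 X * coord 1 Y - coord 1 X * coord 3 Y)"
    "coord 3 (?b X Y) = coord 4 X * coord 5 Y - coord 5 X * coord 4 Y
       + fps_X * (coord 1 X * coord 5 Y - coord 5 X * coord 1 Y)"
    "coord 4 (?b X Y) = fps_X * (coord 3 X * coord 5 Y - coord 5 X * coord 3 Y)"
    "coord 5 (?b X Y) = 0" for X Y
    \<comment> \<open>Reversing \<open>fps_const_neg\<close> pulls signs out of the constants, where
      ring normalisation can see them.\<close>
    by (simp_all add: coord_formal_first_order W3_tilde_table_def L2_direction_def sum_5 axis_def
        fps_const_neg[symmetric] algebra_simps del: fps_const_neg)
  show ?thesis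
    by (simp add: left_leibniz_def fps_vec_eq_iff forall_5 coord_bracket algebra_simps)
qed

lemma left_leibniz_star_direction:
  "left_leibniz (formal_bracket (first_order W3_tilde_table star_direction))"
proof -
  let ?b = "formal_bracket (first_order W3_tilde_table star_direction)"
  have coord_bracket: "coord 1 (?b X Y) = coord 3 X * coord 5 Y - coord 5 X * coord 3 Y
       + fps_X * (coord 4 X * coord 4 Y)"
    "coord 2 (?b X Y) = coord 3 X * coord 4 Y - coord 4 X * coord 3 Y + coord 5 X * coord 5 Y"
    "coord 3 (?b X Y) = coord 4 X * coord 5 Y - coord 5 X * coord 4 Y"
    "coord 4 (?b X Y) = 0"
    "coord 5 (?b X Y) = 0" for X Y
    by (simp_all add: coord_formal_first_order W3_tilde_table_def star_direction_def sum_5 axis_def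
        fps_const_neg[symmetric] algebra_simps del: fps_const_neg)
  show ?thesis
    by (simp add: left_leibniz_def fps_vec_eq_iff forall_5 coord_bracket algebra_simps)
qed

lemma star_direction_iso:
  assumes "t \<noteq> 0"
  shows "table_alg (\<lambda>p. W3_tilde_table p + t *s star_direction p) \<cong>\<^sub>a W3_tilde_star"
proof -
  have curve: "(\<lambda>p. W3_tilde_table p + t *s star_direction p) = W3_tilde_table((4, 4) := t *s e 1)"
    by (auto simp: fun_eq_iff star_direction_def W3_tilde_table_def)
  \<comment> \<open>A cube root of \<open>1 / t\<close>.\<close>
  define b where "b = exp (Ln (1 / t) / 3)"
  have "b \<noteq> 0" by (simp add: b_def)
  have "b ^ 3 = exp (3 * (Ln (1 / t) / 3))"
    unfolding b_def using exp_of_nat_mult[of 3 "Ln (1 / t) / 3"] by simp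
  also have "\<dots> = 1 / t"
    using assms by simp
  finally have t: "t = 1 / b ^ 3" by simp
  \<comment> \<open>\<open>W3_tilde\<close> is graded with \<open>e 1, ..., e 5\<close> in degrees
    5, 4, 3, 1, 2, and \<open>scaling r\<close> multiplies degree \<open>n\<close> by
    \<open>r ^ n\<close>. The extra bracket raises the degree by 3 more than the grading allows, so
    \<open>b ^ 3 * t = 1\<close> normalises it.\<close>
  define scaling where "scaling r x = ((\<chi> i. if i = 1 then r ^ 5 * x$1 else if i = 2 then r ^ 4 * x$2
      else if i = 3 then r ^ 3 * x$3 else if i = 4 then r * x$4 else r ^ 2 * x$5) :: complex ^ 5)"
    for r :: complex and x :: "complex ^ 5"
  have scaling_nth: "scaling r x $ 1 = r ^ 5 * x$1" "scaling r x $ 2 = r ^ 4 * x$2"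
    "scaling r x $ 3 = r ^ 3 * x$3" "scaling r x $ 4 = r * x$4" "scaling r x $ 5 = r ^ 2 * x$5"
    for r x by (simp_all add: scaling_def)
  have "W3_curve t \<cong>\<^sub>a W3_curve 1"
  proof (rule alg_isoI)
    show "Vector_Spaces.linear (scal (W3_curve t)) (scal (W3_curve 1)) (scaling b)"
      by (simp add: Vector_Spaces.linear_iff vec.vector_space_axioms vec_eq_iff forall_5
          scaling_nth algebra_simps)
    show "scaling (1 / b) (scaling b x) = x" "scaling b (scaling (1 / b) x) = x" for x
      using \<open>b \<noteq> 0\<close> by (simp_all add: vec_eq_iff forall_5 scaling_nth field_simps)
    show "scaling b (brac (W3_curve t) x y) = brac (W3_curve 1) (scaling b x) (scaling b y)" for x y
      using \<open>b \<noteq> 0\<close>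
      by (simp add: vec_eq_iff forall_5 scaling_nth brac_W3_curve t field_simps eval_nat_numeral)
  qed
  then show ?thesis
    unfolding curve W3_curve_1 W3_curve_def[symmetric] .
qed

lemma brac_L2_direction:
  fixes t x y
  defines "z \<equiv> brac (table_alg (\<lambda>p. W3_tilde_table p + t *s L2_direction p)) x y"
  shows "z $ 1 = x$3 * y$5 - x$5 * y$3"
    "z $ 2 = x$3 * y$4 - x$4 * y$3 + x$5 * y$5 + t * (x$3 * y$1 - x$1 * y$3)"
    "z $ 3 = x$4 * y$5 - x$5 * y$4 + t * (x$1 * y$5 - x$5 * y$1)"
    "z $ 4 = t * (x$3 * y$5 - x$5 * y$3)"
    "z $ 5 = 0"
  by (simp_all add: z_def table_alg_def W3_tilde_table_def L2_direction_def sum_5 axis_def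
      algebra_simps)

text \<open>
  With \<open>s\<^sup>2 = 2 * t\<close>, \<open>ad e\<^sub>5\<close> has eigenvalues \<open>s\<close> and \<open>- s\<close> on the eigenvectors
  \<open>e\<^sub>1 + t * e\<^sub>4 - s * e\<^sub>3\<close> and \<open>e\<^sub>1 + t * e\<^sub>4 + s * e\<^sub>3\<close>, which play the roles of \<open>e\<^sub>2\<close> and (up to a
  factor) \<open>e\<^sub>1\<close> of \<open>L2\<close>; the central vector \<open>e\<^sub>1 - t * e\<^sub>4\<close> spans the abelian summand.
\<close>

lemma L2_direction_iso:
  assumes "t \<noteq> 0"
  shows "table_alg (\<lambda>p. W3_tilde_table p + t *s L2_direction p) \<cong>\<^sub>a L2 \<oplus>\<^sub>a abelian_line"
proof -
  define s where "s = csqrt (2 * t)"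
  have "s ^ 2 = 2 * t" by (simp add: s_def)
  then have t: "t = s ^ 2 / 2" by simp
  have s: "s \<noteq> 0" using assms by (simp add: s_def)
  define p where "p x = ((\<chi> i. if i = 1 then s ^ 5 * x$1 / 2 + s ^ 4 * x$3 + s ^ 3 * x$4
      else if i = 2 then x$1 / 4 + x$4 / (2 * s ^ 2) - x$3 / (2 * s)
      else if i = 3 then s ^ 2 * x$2 else s * x$5) :: complex ^ 4)" for x :: "complex ^ 5"
  define q where "q x = x$1 / 2 - x$4 / s ^ 2" for x :: "complex ^ 5"
  \<comment> \<open>Sending \<open>e 4\<close> to \<open>e 5 / s\<close> normalises the eigenvalues
    to 1 and -1, and \<open>[e 4, e 4] = e 3\<close> then sends \<open>e 3\<close> to
    \<open>e 2 / s ^ 2\<close>. The two eigenvectors bracket to a multiple of \<open>e 2\<close> by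
    \<open>2 * s ^ 3\<close>, up to sign, whence the factor \<open>1 / (2 * s ^ 5)\<close> on the
    image of \<open>e 1\<close>.\<close>
  define g where "g = (\<lambda>(x :: complex ^ 4, z). (\<chi> i. if i = 1 then x$1 / (2 * s ^ 5) + x$2 + z
      else if i = 2 then x$3 / s ^ 2 else if i = 3 then s * (x$1 / (2 * s ^ 5) - x$2)
      else if i = 4 then s ^ 2 / 2 * (x$1 / (2 * s ^ 5) + x$2 - z) else x$4 / s) :: complex ^ 5)"
  have p_nth: "p x $ 1 = s ^ 5 * x$1 / 2 + s ^ 4 * x$3 + s ^ 3 * x$4"
    "p x $ 2 = x$1 / 4 + x$4 / (2 * s ^ 2) - x$3 / (2 * s)"
    "p x $ 3 = s ^ 2 * x$2" "p x $ 4 = s * x$5" for x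
    by (simp_all add: p_def)
  have g_nth: "g (x, z) $ 1 = x$1 / (2 * s ^ 5) + x$2 + z" "g (x, z) $ 2 = x$3 / s ^ 2"
    "g (x, z) $ 3 = s * (x$1 / (2 * s ^ 5) - x$2)"
    "g (x, z) $ 4 = s ^ 2 / 2 * (x$1 / (2 * s ^ 5) + x$2 - z)" "g (x, z) $ 5 = x$4 / s" for x z
    by (simp_all add: g_def)
  show ?thesis
  proof (rule alg_isoI)
    have "vector_space (scal abelian_line)"
      by (simp add: abelian_line_def vector_space_over_itself.vector_space_axioms)
    then have vs: "vector_space (scal (L2 \<oplus>\<^sub>a abelian_line))"
      by (simp add: vector_space_direct_sum vec.vector_space_axioms)
    have "p (x + y) = p x + p y" "q (x + y) = q x + q y"
      "p (c *s x) = c *s p x" "q (c *s x) = c * q x" for x y c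
      by (simp_all add: vec_eq_iff forall_4 p_nth q_def add_divide_distrib algebra_simps)
    then show "Vector_Spaces.linear (scal (table_alg (\<lambda>p. W3_tilde_table p + t *s L2_direction p)))
        (scal (L2 \<oplus>\<^sub>a abelian_line)) (\<lambda>x. (p x, q x))"
      using vs by (simp add: Vector_Spaces.linear_iff vec.vector_space_axioms abelian_line_def)
    show "g (p x, q x) = x" for x
      using s by (simp add: vec_eq_iff forall_5 g_nth p_nth q_def field_simps eval_nat_numeral)
    have "p (g (x, z)) = x" "q (g (x, z)) = z" for x z
      using s by (simp_all add: vec_eq_iff forall_4 g_nth p_nth q_def field_simps eval_nat_numeral)
    then show "(p (g y), q (g y)) = y" for y
      by (cases y) simp
    fix x y
    let ?z = "brac (table_alg (\<lambda>p. W3_tilde_table p + t *s L2_direction p)) x y"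
    show "(p ?z, q ?z) = brac (L2 \<oplus>\<^sub>a abelian_line) (p x, q x) (p y, q y)"
      using s
      by (simp add: vec_eq_iff forall_4 p_nth brac_L2 brac_L2_direction q_def abelian_line_def
          t field_simps eval_nat_numeral)
  qed
qed

theorem theorem5p5:
  shows "metric_leibniz_algebra W3_tilde \<and> nilpotent_alg W3_tilde \<and>
    leibniz_algebra L2 \<and> leibniz_algebra W3_tilde_star \<and> nilpotent_alg W3_tilde_star \<and>
    (\<exists>\<phi> \<psi>. metric_deformation_to W3_tilde \<phi> (L2 \<oplus>\<^sub>a abelian_line) \<and>
           metric_deformation_to W3_tilde \<psi> W3_tilde_star) \<and>
    \<not> (L2 \<oplus>\<^sub>a abelian_line) \<cong>\<^sub>a W3_tilde_star"
proof -
  have "metric_deformation_to W3_tilde (first_order W3_tilde_table L2_direction)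
      (L2 \<oplus>\<^sub>a abelian_line)"
    unfolding metric_deformation_to_def
  proof (intro conjI)
    show "deformation_to W3_tilde (first_order W3_tilde_table L2_direction) (L2 \<oplus>\<^sub>a abelian_line)"
      unfolding W3_tilde_def
      by (rule deformation_to_first_order[OF left_leibniz_L2_direction L2_direction_iso])
    show "metric_leibniz_algebra (L2 \<oplus>\<^sub>a abelian_line)"
      by (intro metric_leibniz_algebra_direct_sum metric_leibniz_algebra_L2
          metric_leibniz_algebra_abelian_line left_leibniz_L2 left_leibniz_abelian_line)
    \<comment> \<open>The vanishing of triple brackets passes from target to source, so the
      isomorphism is reversed first.\<close>
    show "\<not> W3_tilde \<cong>\<^sub>a (L2 \<oplus>\<^sub>a abelian_line)"
      using not_L2_line_iso_W3_curve[of 0] alg_iso_sym unfolding W3_curve_0 by blast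
  qed
  moreover have "metric_deformation_to W3_tilde (first_order W3_tilde_table star_direction)
      W3_tilde_star"
    unfolding metric_deformation_to_def
  proof (intro conjI)
    show "deformation_to W3_tilde (first_order W3_tilde_table star_direction) W3_tilde_star"
      unfolding W3_tilde_def
      by (rule deformation_to_first_order[OF left_leibniz_star_direction star_direction_iso])
  qed (use metric_leibniz_algebra_W3_curve[of 1] not_W3_tilde_iso_star in \<open>simp_all add: W3_curve_1\<close>)
  ultimately show ?thesis
    using metric_leibniz_algebra_W3_curve[of 0] nilpotent_alg_W3_curve[of 0]
      leibniz_algebra_W3_curve[of 1] nilpotent_alg_W3_curve[of 1] leibniz_algebra_L2
      not_L2_line_iso_W3_curve[of 1]
    unfolding W3_curve_0 W3_curve_1 by blast
qed

end
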